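(* Consider the squared loss $l(x,y)=(x-y)^2$ and $K=2$ experts. For every $T>0$ and every learning strategy which in each of $T$ training rounds queries the advice of only one expert ($m=1$) and then outputs a convex combination $\hat g$ of the two experts ($p=2$), there exists a probability distribution for the experts $\{F_1,F_2\}$ and the target variable $Y$ (all bounded by $1$) such that, with probability at least $0.1$ over the training phase, $$R(\hat g)-R^*\ge\frac{1}{2\sqrt T}.$$
   Context: $T$ is an integer. The experts $F_1,F_2$ and the target $Y$ are real-valued, jointly distributed random variables; the data $(Y_t,F_{1,t},F_{2,t})_{1\le t\le T}$ are i.i.d. copies of $(Y,F_1,F_2)$. In training round $t$ the learner chooses one expert $I_t\in\{1,2\}$ depending on past observations and observes $F_{I_t,t}$ and $Y_t$ only. After $T$ rounds it outputs $\hat g=\hat wF_1+(1-\hat w)F_2$ with $\hat w\in[0,1]$ depending on the observed data. The risk of a forecast $F$ is $R(F):=\mathbb{E}[l(F,Y)]$; $R(\hat g)$ is evaluated on a new draw of $(Y,F_1,F_2)$ independent of the training data (i.e. conditionally on the training data). $R^*:=\min\{R(F_1),R(F_2)\}$. $m$ denotes the number of expert advices that may be queried per training round and $p$ the number of experts that may be combined in the final prediction. *)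

theory Defs
  imports "HOL-Probability.Probability"
begin

text \<open>
  A distribution of the two experts and the target is a Borel probability measure on triples
  \<open>(F\<^sub>1, F\<^sub>2, Y)\<close>; the experts and the target are then the coordinate projections.
\<close>

type_synonym sample = "real \<times> real \<times> real"

definition expert :: "nat \<Rightarrow> sample \<Rightarrow> real" where
  "expert i z = (if i = 1 then fst z else fst (snd z))"

definition target :: "sample \<Rightarrow> real" where
  "target z = snd (snd z)"

definition bounded_distribution :: "sample measure \<Rightarrow> bool" where
  "bounded_distribution D \<longleftrightarrow> prob_space D \<and> sets D = sets borel \<and>
     (AE z in D. \<bar>expert 1 z\<bar> \<le> 1 \<and> \<bar>expert 2 z\<bar> \<le> 1 \<and> \<bar>target z\<bar> \<le> 1)"

definition sq_loss :: "real \<Rightarrow> real \<Rightarrow> real" where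
  "sq_loss x y = (x - y)\<^sup>2"

definition risk :: "sample measure \<Rightarrow> (sample \<Rightarrow> real) \<Rightarrow> real" where
  "risk D f = (\<integral>z. sq_loss (f z) (target z) \<partial>D)"

definition best_risk :: "sample measure \<Rightarrow> real" where
  "best_risk D = min (risk D (expert 1)) (risk D (expert 2))"

definition combination :: "real \<Rightarrow> sample \<Rightarrow> real" where
  "combination w z = w * expert 1 z + (1 - w) * expert 2 z"

text \<open>
  Rounds are numbered from 1. The observation of a round is the pair (advice of the queried expert,
  target), and the observations of the rounds in a set \<open>J\<close> form an element of the product space
  over \<open>J\<close>. A strategy may be randomised: the probability space \<open>S\<close> carries a seed, independent
  of the data, containing all internal randomness of the learner (a deterministic strategy ignores it).
  The learner's own past queries need not be part of the history, since they are determined by the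
  seed and the past observations.
\<close>

abbreviation history_space :: "nat set \<Rightarrow> (nat \<Rightarrow> real \<times> real) measure" where
  "history_space J \<equiv> PiM J (\<lambda>_. borel)"

definition learning_strategy ::
  "nat \<Rightarrow> 's measure \<Rightarrow> (nat \<Rightarrow> 's \<times> (nat \<Rightarrow> real \<times> real) \<Rightarrow> nat) \<Rightarrow>
   ('s \<times> (nat \<Rightarrow> real \<times> real) \<Rightarrow> real) \<Rightarrow> bool" where
  "learning_strategy T S query weight \<longleftrightarrow>
     prob_space S \<and>
     (\<forall>t\<in>{1..T}. query t \<in> S \<Otimes>\<^sub>M history_space {1..<t} \<rightarrow>\<^sub>M count_space {1, 2}) \<and>
     weight \<in> borel_measurable (S \<Otimes>\<^sub>M history_space {1..T}) \<and>
     (\<forall>x\<in>space (S \<Otimes>\<^sub>M history_space {1..T}). weight x \<in> {0..1})"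

text \<open>
  \<open>history query s d n\<close> is what the learner with seed \<open>s\<close> has observed after \<open>n\<close> rounds when the
  full (mostly unseen) training data are \<open>d\<close>; it is \<open>undefined\<close> outside \<open>{1..n}\<close>, as required of
  elements of the product space over \<open>{1..n}\<close>.
\<close>

primrec history ::
  "(nat \<Rightarrow> 's \<times> (nat \<Rightarrow> real \<times> real) \<Rightarrow> nat) \<Rightarrow> 's \<Rightarrow> (nat \<Rightarrow> sample) \<Rightarrow>
   nat \<Rightarrow> nat \<Rightarrow> real \<times> real" where
  "history query s d 0 = (\<lambda>_. undefined)"
| "history query s d (Suc n) =
     (history query s d n)
       (Suc n := (expert (query (Suc n) (s, history query s d n)) (d (Suc n)), target (d (Suc n))))"

definition final_weight ::
  "nat \<Rightarrow> (nat \<Rightarrow> 's \<times> (nat \<Rightarrow> real \<times> real) \<Rightarrow> nat) \<Rightarrow>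
   ('s \<times> (nat \<Rightarrow> real \<times> real) \<Rightarrow> real) \<Rightarrow> 's \<times> (nat \<Rightarrow> sample) \<Rightarrow> real" where
  "final_weight T query weight = (\<lambda>(s, d). weight (s, history query s d T))"

definition training_space :: "nat \<Rightarrow> 's measure \<Rightarrow> sample measure \<Rightarrow> ('s \<times> (nat \<Rightarrow> sample)) measure"
  where "training_space T S D = S \<Otimes>\<^sub>M PiM {1..T} (\<lambda>_. D)"

end

theory Submission
  imports Defs
begin

text \<open>
  Let the target be constantly 1 and let the experts take values in \<open>{-1, 1}\<close>, disagreeing with
  probability \<open>p = 1 / (2 \<surd>T)\<close>; when they disagree, the sign \<open>e\<close> decides which of the two is always
  right. Mixing in weight \<open>v\<close> of the wrong expert costs \<open>4 p v\<^sup>2\<close>, hence at least \<open>p\<close> whenever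
  \<open>v \<ge> 1/2\<close>, so a good learner must identify \<open>e\<close>. As only one expert is seen per round, a round reveals
  just a coin of bias \<open>(1 \<plusminus> p) / 2\<close>, and its Hellinger affinity with the coin seen under the
  opposite sign is \<open>\<surd>(1 - p\<^sup>2)\<close> whichever expert is queried. The squared affinity of the two whole
  histories is therefore \<open>(1 - p\<^sup>2)^T \<ge> 3/4\<close>, too large for a reliable test.
\<close>

section \<open>The hard pair of distributions and its excess risk\<close>

text \<open>The common value of agreeing experts is a fair sign, so for \<open>p\<close> below 1 a
  single observed advice can be 1 or -1 under both values of \<open>e\<close>.\<close>

definition hard_pmf :: "real \<Rightarrow> real \<Rightarrow> sample pmf" where
  "hard_pmf p e = bernoulli_pmf p \<bind> (\<lambda>disagree. if disagree then return_pmf (e, -e, 1)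
     else map_pmf (\<lambda>c. if c then (1, 1, 1) else (-1, -1, 1)) (bernoulli_pmf (1/2)))"

text \<open>The push-forward replaces the discrete sigma-algebra of the pmf by the Borel one that
  \<open>bounded_distribution\<close> asks for.\<close>

definition hard_dist :: "real \<Rightarrow> real \<Rightarrow> sample measure" where
  "hard_dist p e = distr (measure_pmf (hard_pmf p e)) borel (\<lambda>z. z)"

lemma sets_hard_dist [simp, measurable_cong]: "sets (hard_dist p e) = sets borel"
  by (simp add: hard_dist_def)

lemma space_hard_dist [simp]: "space (hard_dist p e) = UNIV"
  by (simp add: hard_dist_def)

lemma prob_space_hard_dist: "prob_space (hard_dist p e)"
  unfolding hard_dist_def by (rule prob_space.prob_space_distr) (auto intro: prob_space_measure_pmf)

lemma set_hard_pmf: "set_pmf (hard_pmf p e) \<subseteq> {(e, -e, 1), (1, 1, 1), (-1, -1, 1)}"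
  by (auto simp: hard_pmf_def split: if_splits)

lemma measurable_expert [measurable]: "expert i \<in> borel_measurable borel"
  unfolding expert_def by (cases "i = 1") (auto intro!: borel_measurable_continuous_onI continuous_intros)

lemma measurable_target [measurable]: "target \<in> borel_measurable borel"
  unfolding target_def by (auto intro!: borel_measurable_continuous_onI continuous_intros)

lemma bounded_hard_dist:
  assumes "\<bar>e\<bar> \<le> 1"
  shows "bounded_distribution (hard_dist p e)"
proof -
  have "AE z in hard_dist p e. \<bar>expert 1 z\<bar> \<le> 1 \<and> \<bar>expert 2 z\<bar> \<le> 1 \<and> \<bar>target z\<bar> \<le> 1"
    unfolding hard_dist_def
  proof (subst AE_distr_iff)
    show "{z \<in> space borel. \<bar>expert 1 z\<bar> \<le> 1 \<and> \<bar>expert 2 z\<bar> \<le> 1 \<and> \<bar>target z\<bar> \<le> 1} \<in> sets borel"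
      by measurable
  qed (use assms set_hard_pmf[of p e] in \<open>auto simp: AE_measure_pmf_iff expert_def target_def\<close>)
  then show ?thesis
    by (simp add: bounded_distribution_def prob_space_hard_dist)
qed

text \<open>Stated for the nonnegative integral because the product measure is later integrated
  round by round in this form.\<close>

lemma nn_integral_hard_dist:
  assumes [measurable]: "u \<in> borel_measurable borel" and "\<And>z. 0 \<le> u z" and "0 \<le> p" "p \<le> 1"
  shows "(\<integral>\<^sup>+ z. ennreal (u z) \<partial>hard_dist p e) =
    ennreal (p * u (e, -e, 1) + (1 - p) / 2 * (u (1, 1, 1) + u (-1, -1, 1)))"
proof -
  have coin: "(\<integral>\<^sup>+ b. ennreal (v b) \<partial>bernoulli_pmf r) = ennreal (r * v True + (1 - r) * v False)"
    if "\<And>b. 0 \<le> v b" "0 \<le> r" "r \<le> 1" for v r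
    using that by (simp add: ennreal_mult' ennreal_plus mult.commute)
  let ?v = "\<lambda>b. if b then u (e, -e, 1) else (u (1, 1, 1) + u (-1, -1, 1)) / 2"
  have "(\<integral>\<^sup>+ z. ennreal (u z) \<partial>hard_dist p e) = (\<integral>\<^sup>+ b. ennreal (?v b) \<partial>bernoulli_pmf p)"
    unfolding hard_dist_def hard_pmf_def
  proof (subst nn_integral_distr, simp, simp, subst nn_integral_bind_pmf, rule nn_integral_cong)
    fix b
    show "(\<integral>\<^sup>+ z. ennreal (u z) \<partial>(if b then return_pmf (e, -e, 1)
      else map_pmf (\<lambda>c. if c then (1, 1, 1) else (-1, -1, 1)) (bernoulli_pmf (1/2)))) = ennreal (?v b)"
      using assms(2) coin[of "\<lambda>c. u (if c then (1, 1, 1) else (-1, -1, 1))" "1/2"]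
      by (simp add: nn_integral_return_pmf nn_integral_map_pmf add_divide_distrib del: nn_integral_bernoulli_pmf)
  qed
  also have "\<dots> = ennreal (p * u (e, -e, 1) + (1 - p) / 2 * (u (1, 1, 1) + u (-1, -1, 1)))"
    using assms(2-) by (subst coin) auto
  finally show ?thesis .
qed

lemma integral_hard_dist:
  assumes [measurable]: "u \<in> borel_measurable borel" and "\<And>z. 0 \<le> u z" and "0 \<le> p" "p \<le> 1"
  shows "(\<integral>z. u z \<partial>hard_dist p e) =
    p * u (e, -e, 1) + (1 - p) / 2 * (u (1, 1, 1) + u (-1, -1, 1))"
  using assms by (subst integral_eq_nn_integral) (auto simp: nn_integral_hard_dist simp del: ennreal_plus)

lemma risk_hard_dist:
  assumes [measurable]: "f \<in> borel_measurable borel" and "0 \<le> p" "p \<le> 1"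
  shows "risk (hard_dist p e) f =
    p * (f (e, -e, 1) - 1)\<^sup>2 + (1 - p) / 2 * ((f (1, 1, 1) - 1)\<^sup>2 + (f (-1, -1, 1) - 1)\<^sup>2)"
proof -
  have "(\<lambda>z. sq_loss (f z) (target z)) \<in> borel_measurable borel"
    unfolding sq_loss_def by measurable
  then show ?thesis
    unfolding risk_def using assms(2-)
    by (subst integral_hard_dist) (auto simp: sq_loss_def target_def)
qed

text \<open>Where the experts agree, every combination has the same loss as either expert. Where
  they disagree, the right expert has loss 0 and the combination takes the value
  \<open>e * (2 * w - 1)\<close>.\<close>

lemma excess_risk_hard_dist:
  assumes "0 \<le> p" "p \<le> 1" and "e = 1 \<or> e = -1"
  shows "risk (hard_dist p e) (combination w) - best_risk (hard_dist p e) =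
    p * (e * (2 * w - 1) - 1)\<^sup>2"
proof -
  have comb: "combination w \<in> borel_measurable borel"
    unfolding combination_def by measurable
  show ?thesis
    using assms unfolding best_risk_def
    by (auto simp: risk_hard_dist[OF measurable_expert] risk_hard_dist[OF comb] combination_def expert_def
        min_def power2_eq_square field_simps)
qed

section \<open>Locality and measurability of histories\<close>

lemma history_cong:
  assumes "\<And>t. t \<in> {1..n} \<Longrightarrow> d t = d' t"
  shows "history query s d n = history query s d' n"
  using assms by (induction n) auto

text \<open>The index set \<open>I\<close> is kept apart from \<open>n\<close>, so that the
  induction shortens the history while the data space stays fixed.\<close>

lemma measurable_history:
  assumes "\<forall>t\<in>{1..n}. query t \<in> S \<Otimes>\<^sub>M history_space {1..<t} \<rightarrow>\<^sub>M count_space {1, 2}"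
    and "{1..n} \<subseteq> I" and "sets D = sets borel"
  shows "(\<lambda>x. history query (fst x) (snd x) n) \<in> S \<Otimes>\<^sub>M PiM I (\<lambda>_. D) \<rightarrow>\<^sub>M history_space {1..n}"
  using assms(1,2)
proof (induction n)
  case 0
  then show ?case by (simp add: measurable_const space_PiM_empty)
next
  case (Suc n)
  note [measurable_cong] = assms(3)
  have ivl: "{1..<Suc n} = {1..n}" "{1..Suc n} = insert (Suc n) {1..n}"
    by auto
  have hist [measurable]: "(\<lambda>x. history query (fst x) (snd x) n)
      \<in> S \<Otimes>\<^sub>M PiM I (\<lambda>_. D) \<rightarrow>\<^sub>M history_space {1..n}"
    using Suc.prems by (intro Suc.IH) auto
  have q: "query (Suc n) \<in> S \<Otimes>\<^sub>M history_space {1..n} \<rightarrow>\<^sub>M count_space {1, 2}"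
    using Suc.prems(1) ivl(1) by (metis atLeastAtMost_iff le_add1 order_refl plus_1_eq_Suc)
  have [measurable]: "(\<lambda>x. query (Suc n) (fst x, history query (fst x) (snd x) n))
      \<in> S \<Otimes>\<^sub>M PiM I (\<lambda>_. D) \<rightarrow>\<^sub>M count_space {1, 2}"
    by (rule measurable_compose[OF _ q]) measurable
  have "(\<lambda>x. snd x (Suc n)) \<in> S \<Otimes>\<^sub>M PiM I (\<lambda>_. D) \<rightarrow>\<^sub>M D"
    using Suc.prems(2)
    by (intro measurable_compose[OF measurable_snd measurable_component_singleton]) auto
  \<comment> \<open>The Borel sigma-algebra on triples is the product one, which makes the
    coordinate projections measurable.\<close>
  then have [measurable]:
    "(\<lambda>x. snd x (Suc n)) \<in> S \<Otimes>\<^sub>M PiM I (\<lambda>_. D) \<rightarrow>\<^sub>M borel \<Otimes>\<^sub>M borel \<Otimes>\<^sub>M borel"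
    unfolding borel_prod measurable_cong_sets[OF refl assms(3)] .
  have obs: "(\<lambda>x. (expert (query (Suc n) (fst x, history query (fst x) (snd x) n)) (snd x (Suc n)),
      target (snd x (Suc n)))) \<in> S \<Otimes>\<^sub>M PiM I (\<lambda>_. D) \<rightarrow>\<^sub>M borel"
    unfolding expert_def target_def borel_prod [symmetric] by measurable
  show ?case
    unfolding ivl history.simps by (rule measurable_fun_upd[where J = "{1..n}" and M = "\<lambda>_. borel", OF _ hist obs]) simp
qed

section \<open>Affinity of the two laws of the history\<close>

text \<open>Cauchy-Schwarz for two coins of opposite bias, squared to avoid roots: each face
  contributes sqrt(1 - q^2) / 2 to their affinity.\<close>

lemma coin_affinity:
  fixes q k x1 x2 y1 y2 :: real
  assumes "\<bar>q\<bar> \<le> 1" "0 \<le> k" "0 \<le> x1" "0 \<le> x2" "0 \<le> y1" "0 \<le> y2" "k \<le> x1 * y1" "k \<le> x2 * y2"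
  shows "(1 - q\<^sup>2) * k \<le>
    ((1 + q) / 2 * x1 + (1 - q) / 2 * x2) * ((1 - q) / 2 * y1 + (1 + q) / 2 * y2)"
proof -
  \<comment> \<open>Up to a factor 4, \<open>A\<close> and \<open>B\<close> are the cross terms of
    the expanded product. AM-GM bounds them below by half of the claim; the diagonal terms give the
    other half.\<close>
  define A where "A = (1 + q)\<^sup>2 * (x1 * y2)"
  define B where "B = (1 - q)\<^sup>2 * (x2 * y1)"
  have q2: "q\<^sup>2 \<le> 1"
    using assms(1) by (simp add: abs_square_le_1)
  have "k * k \<le> (x1 * y1) * (x2 * y2)"
    using assms by (intro mult_mono) auto
  then have "((1 - q\<^sup>2) * k)\<^sup>2 \<le> (1 - q\<^sup>2)\<^sup>2 * ((x1 * y1) * (x2 * y2))"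
    by (simp add: power_mult_distrib power2_eq_square[of k] mult_left_mono)
  also have "\<dots> = A * B"
    by (simp add: A_def B_def power2_eq_square algebra_simps)
  finally have "4 * ((1 - q\<^sup>2) * k)\<^sup>2 \<le> (A + B)\<^sup>2"
    using sum_squares_ge_zero[of "A - B" 0] by (simp add: power2_eq_square algebra_simps)
  then have "(2 * ((1 - q\<^sup>2) * k))\<^sup>2 \<le> (A + B)\<^sup>2"
    by (simp add: power_mult_distrib)
  moreover have "0 \<le> A + B"
    using assms by (simp add: A_def B_def)
  ultimately have AB: "2 * ((1 - q\<^sup>2) * k) \<le> A + B"
    using power2_le_imp_le by blast
  have "(1 - q\<^sup>2) * (k + k) \<le> (1 - q\<^sup>2) * (x1 * y1 + x2 * y2)"
    using assms q2 by (intro mult_left_mono) auto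
  then show ?thesis
    using AB by (simp add: A_def B_def power2_eq_square field_simps)
qed

text \<open>Fubini integrates out the last round: \<open>f'\<close> is the conditional expectation
  of \<open>f\<close> given the first \<open>n\<close> rounds, the observed advice being 1 with
  probability \<open>(1 + e * q h) / 2\<close>. As \<open>q\<close> does not involve
  \<open>e\<close>, one \<open>q\<close> serves both signs.\<close>

lemma nn_integral_history_Suc:
  fixes f :: "(nat \<Rightarrow> real \<times> real) \<Rightarrow> real"
  assumes query: "\<forall>t\<in>{1..Suc n}. query t \<in> S \<Otimes>\<^sub>M history_space {1..<t} \<rightarrow>\<^sub>M count_space {1, 2}"
    and s: "s \<in> space S"
    and f [measurable]: "f \<in> borel_measurable (history_space {1..Suc n})" and f0: "\<And>h. 0 \<le> f h"
    and p: "0 \<le> p" "p \<le> 1" and e: "e = 1 \<or> e = -1"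
    and q: "\<And>h. q h = (if query (Suc n) (s, h) = 1 then p else - p)"
    and f': "\<And>h. f' h = (1 + e * q h) / 2 * f (h(Suc n := (1, 1))) +
      (1 - e * q h) / 2 * f (h(Suc n := (-1, 1)))"
  shows "f' \<in> borel_measurable (history_space {1..n})"
    and "(\<integral>\<^sup>+ d. ennreal (f (history query s d (Suc n))) \<partial>PiM {1..Suc n} (\<lambda>_. hard_dist p e)) =
      (\<integral>\<^sup>+ d. ennreal (f' (history query s d n)) \<partial>PiM {1..n} (\<lambda>_. hard_dist p e))"
proof -
  have ivl: "{1..<Suc n} = {1..n}" "{1..Suc n} = insert (Suc n) {1..n}"
    by auto
  have "query (Suc n) \<in> S \<Otimes>\<^sub>M history_space {1..n} \<rightarrow>\<^sub>M count_space {1, 2}"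
    using query ivl(1) by (metis atLeastAtMost_iff le_add1 order_refl plus_1_eq_Suc)
  from measurable_compose[OF measurable_Pair1'[OF s] this]
  have [measurable]: "(\<lambda>h. query (Suc n) (s, h)) \<in> history_space {1..n} \<rightarrow>\<^sub>M count_space {1, 2}" .
  have upd [measurable]: "(\<lambda>h. f (h(Suc n := c))) \<in> borel_measurable (history_space {1..n})" for c
    by (rule measurable_compose[OF _ f], unfold ivl, rule measurable_fun_upd[where J = "{1..n}"]) auto
  show "f' \<in> borel_measurable (history_space {1..n})"
    unfolding f' q by measurable
  interpret D: prob_space "hard_dist p e"
    by (rule prob_space_hard_dist)
  interpret product_sigma_finite "\<lambda>_. hard_dist p e"
    by standard
  have "(\<lambda>d. history query s d (Suc n)) \<in>
      PiM {1..Suc n} (\<lambda>_. hard_dist p e) \<rightarrow>\<^sub>M history_space {1..Suc n}"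
    using measurable_compose[OF measurable_Pair1'[OF s] measurable_history[OF query order_refl]]
    by simp
  from measurable_compose[OF this f]
  have fh: "(\<lambda>d. f (history query s d (Suc n))) \<in>
      borel_measurable (PiM (insert (Suc n) {1..n}) (\<lambda>_. hard_dist p e))"
    unfolding ivl .
  have "(\<integral>\<^sup>+ d. ennreal (f (history query s d (Suc n))) \<partial>PiM {1..Suc n} (\<lambda>_. hard_dist p e)) =
    (\<integral>\<^sup>+ d. (\<integral>\<^sup>+ z. ennreal (f (history query s (d(Suc n := z)) (Suc n))) \<partial>hard_dist p e)
      \<partial>PiM {1..n} (\<lambda>_. hard_dist p e))"
    unfolding ivl using fh by (subst product_nn_integral_insert) auto
  also have "\<dots> = (\<integral>\<^sup>+ d. ennreal (f' (history query s d n)) \<partial>PiM {1..n} (\<lambda>_. hard_dist p e))"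
  proof (rule nn_integral_cong)
    fix d assume d: "d \<in> space (PiM {1..n} (\<lambda>_. hard_dist p e))"
    let ?h = "history query s d n"
    let ?i = "query (Suc n) (s, ?h)"
    let ?u = "\<lambda>z. f (?h(Suc n := (expert ?i z, target z)))"
    have u: "f (history query s (d(Suc n := z)) (Suc n)) = ?u z" for z
      using history_cong[of n "d(Suc n := z)" d query s] by simp
    \<comment> \<open>Measurability in the new sample alone comes from taking a section of
      \<open>fh\<close> at the fixed \<open>d\<close>.\<close>
    have "(\<lambda>z. f (history query s (d(Suc n := z)) (Suc n))) \<in> borel_measurable borel"
    proof -
      have "(\<lambda>z. d(Suc n := z)) \<in> hard_dist p e \<rightarrow>\<^sub>M PiM (insert (Suc n) {1..n}) (\<lambda>_. hard_dist p e)"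
        using d by (intro measurable_fun_upd[where J = "{1..n}"]) auto
      from measurable_compose[OF this fh] show ?thesis by simp
    qed
    then have "?u \<in> borel_measurable borel"
      by (simp only: u)
    from nn_integral_hard_dist[OF this f0 p, of e]
    have "(\<integral>\<^sup>+ z. ennreal (?u z) \<partial>hard_dist p e) =
      ennreal (p * ?u (e, -e, 1) + (1 - p) / 2 * (?u (1, 1, 1) + ?u (-1, -1, 1)))" .
    \<comment> \<open>The disagreement atom adds its mass \<open>p\<close> to one of the two
      observations of mass \<open>(1 - p) / 2\<close>; the queried expert and \<open>e\<close>
      decide to which one.\<close>
    also have "p * ?u (e, -e, 1) + (1 - p) / 2 * (?u (1, 1, 1) + ?u (-1, -1, 1)) = f' ?h"
      using e by (auto simp: f' q expert_def target_def field_simps)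
    finally show "(\<integral>\<^sup>+ z. ennreal (f (history query s (d(Suc n := z)) (Suc n))) \<partial>hard_dist p e) =
        ennreal (f' ?h)"
      by (simp only: u)
  qed
  finally show "(\<integral>\<^sup>+ d. ennreal (f (history query s d (Suc n))) \<partial>PiM {1..Suc n} (\<lambda>_. hard_dist p e)) =
      (\<integral>\<^sup>+ d. ennreal (f' (history query s d n)) \<partial>PiM {1..n} (\<lambda>_. hard_dist p e))" .
qed

text \<open>Removing the last round turns \<open>f\<close>, \<open>g\<close>, \<open>k\<close> into
  \<open>f'\<close>, \<open>g'\<close>, \<open>(1 - p\<^sup>2) * k\<close> by
  \<open>coin_affinity\<close>. A pointwise bound on the product thus propagates back to the empty
  history, where the integrals are point values.\<close>

lemma history_affinity:
  fixes f g :: "(nat \<Rightarrow> real \<times> real) \<Rightarrow> real"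
  assumes "\<forall>t\<in>{1..n}. query t \<in> S \<Otimes>\<^sub>M history_space {1..<t} \<rightarrow>\<^sub>M count_space {1, 2}"
    and s: "s \<in> space S"
    and p: "0 \<le> p" "p \<le> 1"
    and "f \<in> borel_measurable (history_space {1..n})" "g \<in> borel_measurable (history_space {1..n})"
    and "\<And>h. 0 \<le> f h" "\<And>h. 0 \<le> g h"
    and "0 \<le> k" "\<And>h. k \<le> f h * g h"
  shows "ennreal ((1 - p\<^sup>2) ^ n * k) \<le>
    (\<integral>\<^sup>+ d. ennreal (f (history query s d n)) \<partial>PiM {1..n} (\<lambda>_. hard_dist p 1)) *
    (\<integral>\<^sup>+ d. ennreal (g (history query s d n)) \<partial>PiM {1..n} (\<lambda>_. hard_dist p (-1)))"
  using assms(1,5-)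
proof (induction n arbitrary: f g k)
  case 0
  then show ?case
    by (simp add: PiM_empty nn_integral_count_space_finite ennreal_mult' [symmetric])
next
  case (Suc n)
  define q where "q h = (if query (Suc n) (s, h) = 1 then p else - p)" for h
  \<comment> \<open>The query affects only the sign of the bias, not its square, so adaptive choices
    lose the same factor in each round.\<close>
  have q: "\<bar>q h\<bar> \<le> 1" "(q h)\<^sup>2 = p\<^sup>2" for h
    using p by (auto simp: q_def)
  have p2: "0 \<le> 1 - p\<^sup>2"
    using p by (simp add: power_le_one)
  \<comment> \<open>The factors \<open>1\<close> and \<open>(-1)\<close> make the definitions match
    the equation for \<open>f'\<close> in \<open>nn_integral_history_Suc\<close> at the two
    signs.\<close>
  define f' where "f' h = (1 + 1 * q h) / 2 * f (h(Suc n := (1, 1))) +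
    (1 - 1 * q h) / 2 * f (h(Suc n := (-1, 1)))" for h
  define g' where "g' h = (1 + (-1) * q h) / 2 * g (h(Suc n := (1, 1))) +
    (1 - (-1) * q h) / 2 * g (h(Suc n := (-1, 1)))" for h
  note f' = nn_integral_history_Suc[OF Suc.prems(1) s Suc.prems(2,4) p, of 1 q f', OF disjI1[OF refl] q_def f'_def]
  note g' = nn_integral_history_Suc[OF Suc.prems(1) s Suc.prems(3,5) p, of "-1" q g', OF disjI2[OF refl] q_def g'_def]
  have "(1 - p\<^sup>2) * k \<le> f' h * g' h" for h
    using coin_affinity[of "q h" k "f (h(Suc n := (1, 1)))" "f (h(Suc n := (-1, 1)))"
        "g (h(Suc n := (1, 1)))" "g (h(Suc n := (-1, 1)))"] q[of h] Suc.prems(4-)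
    by (simp add: f'_def g'_def)
  moreover have "0 \<le> f' h" "0 \<le> g' h" for h
    using q(1)[of h] Suc.prems(4,5) by (auto simp: f'_def g'_def intro!: add_nonneg_nonneg mult_nonneg_nonneg)
  ultimately have "ennreal ((1 - p\<^sup>2) ^ n * ((1 - p\<^sup>2) * k)) \<le>
    (\<integral>\<^sup>+ d. ennreal (f' (history query s d n)) \<partial>PiM {1..n} (\<lambda>_. hard_dist p 1)) *
    (\<integral>\<^sup>+ d. ennreal (g' (history query s d n)) \<partial>PiM {1..n} (\<lambda>_. hard_dist p (-1)))"
    using Suc.prems f'(1) g'(1) p2 by (intro Suc.IH) auto
  then show ?case
    using f'(2) g'(2) by (simp add: mult_ac del: history.simps)
qed

section \<open>The two-point argument\<close>

theorem lemma6p2: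
  fixes T :: nat
    and S :: "'s measure"
    and query :: "nat \<Rightarrow> 's \<times> (nat \<Rightarrow> real \<times> real) \<Rightarrow> nat"
    and weight :: "'s \<times> (nat \<Rightarrow> real \<times> real) \<Rightarrow> real"
  assumes "T > 0"
    and "learning_strategy T S query weight"
  shows "\<exists>D. bounded_distribution D \<and>
    measure (training_space T S D)
      {x \<in> space (training_space T S D).
         risk D (combination (final_weight T query weight x)) - best_risk D \<ge> 1 / (2 * sqrt (real T))}
      \<ge> 0.1"
proof -
  \<comment> \<open>This \<open>p\<close> equals the claimed gap, and \<open>T * p\<^sup>2\<close>
    is 1/4, so Bernoulli's inequality keeps the squared affinity above 3/4.\<close>
  define p where "p = 1 / (2 * sqrt (real T))"
  define r where "r = sqrt (real T)"
  have "1 \<le> r" "r\<^sup>2 = real T"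
    using \<open>T > 0\<close> by (simp_all add: r_def)
  then have p: "0 < p" "p \<le> 1" and p2: "p\<^sup>2 = 1 / (4 * real T)"
    unfolding p_def r_def [symmetric] by (simp_all add: field_simps)
  have "1 + real T * (- p\<^sup>2) \<le> (1 + (- p\<^sup>2)) ^ T"
    using p by (intro Bernoulli_inequality) (simp add: power_le_one)
  then have affinity: "3 / 4 \<le> (1 - p\<^sup>2) ^ T"
    using \<open>T > 0\<close> by (simp add: p2)

  interpret S: prob_space S
    using assms(2) by (simp add: learning_strategy_def)
  have query: "\<forall>t\<in>{1..T}. query t \<in> S \<Otimes>\<^sub>M history_space {1..<t} \<rightarrow>\<^sub>M count_space {1, 2}"
    and weight: "weight \<in> borel_measurable (S \<Otimes>\<^sub>M history_space {1..T})"
    using assms(2) by (auto simp: learning_strategy_def)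

  \<comment> \<open>By \<open>excess_risk_hard_dist\<close>, \<open>bad e w\<close> says that the
    excess risk is at least \<open>p\<close>. For a weight in [0,1] this means weight at least 1/2
    on the wrong expert.\<close>
  define bad where "bad = (\<lambda>(e::real) w. 1 \<le> (e * (2 * w - 1) - 1)\<^sup>2)"
  have bad_or: "bad 1 w \<or> bad (-1) w" for w
  proof (cases "w \<le> 1 / 2")
    case True
    then have "1 \<le> (2 - 2 * w)\<^sup>2" by (intro one_le_power) auto
    then show ?thesis by (simp add: bad_def power2_eq_square algebra_simps)
  next
    case False
    then have "1 \<le> (2 * w)\<^sup>2" by (intro one_le_power) auto
    then show ?thesis by (simp add: bad_def power2_eq_square algebra_simps)
  qed

  define P where "P = (\<lambda>e. PiM {1..T} (\<lambda>_. hard_dist p e))"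
  define E where "E = (\<lambda>e. {x \<in> space (S \<Otimes>\<^sub>M P e). bad e (final_weight T query weight x)})"
  \<comment> \<open>The failure probability conditional on the seed \<open>s\<close>; fixing the
    seed makes the strategy deterministic.\<close>
  define m where "m = (\<lambda>e s. measure (P e) {d \<in> space (P e). bad e (weight (s, history query s d T))})"
  have m_nonneg: "0 \<le> m e s" for e s
    by (simp add: m_def)
  have P: "prob_space (P e)" for e
    unfolding P_def by (intro prob_space_PiM prob_space_hard_dist)

  have "(\<lambda>x. (fst x, history query (fst x) (snd x) T)) \<in> S \<Otimes>\<^sub>M P e \<rightarrow>\<^sub>M S \<Otimes>\<^sub>M history_space {1..T}" for e
    using measurable_history[OF query order_refl, of "hard_dist p e"]
    by (intro measurable_Pair) (auto simp: P_def)
  from measurable_compose[OF this weight]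
  have W: "final_weight T query weight \<in> borel_measurable (S \<Otimes>\<^sub>M P e)" for e
    by (simp add: final_weight_def case_prod_unfold)
  have E [measurable]: "E e \<in> sets (S \<Otimes>\<^sub>M P e)" for e
    using W[of e] unfolding E_def bad_def by measurable

  have event: "{x \<in> space (training_space T S (hard_dist p e)).
      risk (hard_dist p e) (combination (final_weight T query weight x)) - best_risk (hard_dist p e)
        \<ge> 1 / (2 * sqrt (real T))} = E e"
    and space: "training_space T S (hard_dist p e) = S \<Otimes>\<^sub>M P e"
    if "e = 1 \<or> e = -1" for e
    using p that
    by (auto simp: E_def bad_def P_def training_space_def excess_risk_hard_dist p_def [symmetric])

  have slice: "Pair s -` E e = {d \<in> space (P e). bad e (weight (s, history query s d T))}"
    if "s \<in> space S" for e s
    using that by (auto simp: E_def space_pair_measure final_weight_def)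
  have emeasure_E: "emeasure (S \<Otimes>\<^sub>M P e) (E e) = (\<integral>\<^sup>+ s. ennreal (m e s) \<partial>S)" for e
  proof -
    interpret P: prob_space "P e" by (rule P)
    show ?thesis
      unfolding P.emeasure_pair_measure_alt[OF E]
      by (intro nn_integral_cong) (simp add: m_def slice P.emeasure_eq_measure)
  qed
  have m_meas [measurable]: "m e \<in> borel_measurable S" for e
  proof -
    interpret P: prob_space "P e" by (rule P)
    have "(\<lambda>s. measure (P e) (Pair s -` E e)) \<in> borel_measurable S"
      unfolding measure_def using P.measurable_emeasure_Pair[OF E] by measurable
    then show ?thesis
      by (rule measurable_cong[THEN iffD1, rotated]) (simp add: m_def slice)
  qed

  \<comment> \<open>The offset \<open>1/4\<close> makes the product of the two error indicators positive everywhere.\<close>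
  define f where "f = (\<lambda>e s h. of_bool (bad e (weight (s, h))) + 1 / 4 :: real)"
  have integral_f: "(\<integral>\<^sup>+ d. ennreal (f e s (history query s d T)) \<partial>P e) = ennreal (m e s + 1 / 4)"
    if s: "s \<in> space S" for e s
  proof -
    interpret P: prob_space "P e" by (rule P)
    have [measurable]: "{d \<in> space (P e). bad e (weight (s, history query s d T))} \<in> sets (P e)"
      using sets_Pair1[OF E, of s e] by (simp add: slice[OF s])
    have "(\<integral>\<^sup>+ d. ennreal (f e s (history query s d T)) \<partial>P e) =
      (\<integral>\<^sup>+ d. indicator {d \<in> space (P e). bad e (weight (s, history query s d T))} d + ennreal (1 / 4) \<partial>P e)"
      by (intro nn_integral_cong) (auto simp: f_def indicator_def simp flip: ennreal_1 ennreal_plus)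
    also have "\<dots> = emeasure (P e) {d \<in> space (P e). bad e (weight (s, history query s d T))} + ennreal (1 / 4)"
      by (subst nn_integral_add) (auto simp: P.emeasure_space_1)
    also have "\<dots> = ennreal (m e s) + ennreal (1 / 4)"
      by (simp add: m_def P.emeasure_eq_measure)
    finally show ?thesis by (simp add: m_def)
  qed

  have m_sum: "2 / 5 \<le> m 1 s + m (-1) s" if s: "s \<in> space S" for s
  proof -
    have f_meas: "f e s \<in> borel_measurable (history_space {1..T})" for e
    proof -
      have [measurable]: "(\<lambda>h. weight (s, h)) \<in> borel_measurable (history_space {1..T})"
        by (rule measurable_compose[OF measurable_Pair1'[OF s] weight])
      show ?thesis unfolding f_def bad_def by measurable
    qed
    have "ennreal ((1 - p\<^sup>2) ^ T * (5 / 16)) \<le> ennreal (m 1 s + 1 / 4) * ennreal (m (-1) s + 1 / 4)"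
      unfolding integral_f[OF s, symmetric] unfolding P_def
    proof (rule history_affinity[OF query s])
      \<comment> \<open>By \<open>bad_or\<close> one factor is 5/4, and the other is at least
        1/4.\<close>
      show "5 / 16 \<le> f 1 s h * f (-1) s h" for h
        using bad_or[of "weight (s, h)"] by (auto simp: f_def)
    qed (use p f_meas in \<open>auto simp: f_def\<close>)
    then have "(1 - p\<^sup>2) ^ T * (5 / 16) \<le> (m 1 s + 1 / 4) * (m (-1) s + 1 / 4)"
      using m_nonneg by (simp add: ennreal_mult' [symmetric] ennreal_le_iff del: ennreal_plus)
    then have "15 / 64 \<le> (m 1 s + 1 / 4) * (m (-1) s + 1 / 4)"
      using affinity by simp
    moreover have "4 * ((m 1 s + 1 / 4) * (m (-1) s + 1 / 4)) \<le> (m 1 s + m (-1) s + 1 / 2)\<^sup>2"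
      using zero_le_square[of "m 1 s - m (-1) s"] by (simp add: power2_eq_square algebra_simps)
    \<comment> \<open>Here 4 * 15/64 = 15/16 exceeds 81/100. Removing the two offsets of 1/4 from
      9/10 leaves 2/5.\<close>
    ultimately have "(9 / 10)\<^sup>2 \<le> (m 1 s + m (-1) s + 1 / 2)\<^sup>2"
      by (simp add: power2_eq_square)
    then have "9 / 10 \<le> m 1 s + m (-1) s + 1 / 2"
      using m_nonneg[of 1 s] m_nonneg[of "-1" s] by (elim power2_le_imp_le) linarith
    then show ?thesis by simp
  qed

  \<comment> \<open>The distribution may not depend on the seed, so the sum of both failure
    probabilities is averaged over the seed before a sign is chosen.\<close>
  have "ennreal (2 / 5) = (\<integral>\<^sup>+ s. ennreal (2 / 5) \<partial>S)"
    by (simp add: S.emeasure_space_1)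
  also have "\<dots> \<le> (\<integral>\<^sup>+ s. ennreal (m 1 s) + ennreal (m (-1) s) \<partial>S)"
    using ennreal_leI[OF m_sum] by (intro nn_integral_mono) (simp add: m_nonneg)
  also have "\<dots> = emeasure (S \<Otimes>\<^sub>M P 1) (E 1) + emeasure (S \<Otimes>\<^sub>M P (-1)) (E (-1))"
    by (simp add: nn_integral_add emeasure_E)
  also have "\<dots> = ennreal (measure (S \<Otimes>\<^sub>M P 1) (E 1) + measure (S \<Otimes>\<^sub>M P (-1)) (E (-1)))"
  proof -
    have "prob_space (S \<Otimes>\<^sub>M P e)" for e
      by (intro prob_space_pair S.prob_space_axioms P)
    then show ?thesis
      by (simp add: finite_measure.emeasure_eq_measure prob_space.finite_measure)
  qed
  finally have "2 / 5 \<le> measure (S \<Otimes>\<^sub>M P 1) (E 1) + measure (S \<Otimes>\<^sub>M P (-1)) (E (-1))"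
    by (subst (asm) ennreal_le_iff) auto
  \<comment> \<open>One of two numbers with sum at least 2/5 is at least 1/5, hence at least
    0.1.\<close>
  then have "0.1 \<le> measure (S \<Otimes>\<^sub>M P 1) (E 1) \<or> 0.1 \<le> measure (S \<Otimes>\<^sub>M P (-1)) (E (-1))"
    by linarith
  then obtain e :: real where e: "e = 1 \<or> e = -1" and "0.1 \<le> measure (S \<Otimes>\<^sub>M P e) (E e)"
    by blast
  with bounded_hard_dist[of e p] show ?thesis
    unfolding event[OF e, symmetric] space[OF e, symmetric] by (intro exI[of _ "hard_dist p e"]) auto
qed

end
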